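(* Let $(\mathfrak{g},\varphi,\xi,\eta,g)$ be a $5$-dimensional anti-quasi-Sasakian Lie algebra which is not cokähler. Then, up to a homothetic deformation of the structure, $\mathfrak{g}$ is isomorphic to the Heisenberg Lie algebra $\mathfrak{h}_5$.
   Context: All Lie algebras are real; $d$ is the Chevalley–Eilenberg differential, so $d\eta(X,Y)=-\eta([X,Y])$ for a $1$-form $\eta$. An almost contact metric Lie algebra $(\mathfrak{g},\varphi,\xi,\eta,g)$ is an odd-dimensional Lie algebra $\mathfrak{g}$ with $\varphi\in\mathrm{End}(\mathfrak{g})$, $\xi\in\mathfrak{g}$, $\eta\in\mathfrak{g}^*$ and a positive-definite inner product $g$ such that $\varphi^2=-I+\eta\otimes\xi$, $\eta(\xi)=1$, $g(\varphi X,\varphi Y)=g(X,Y)-\eta(X)\eta(Y)$. Its fundamental $2$-form is $\Phi(X,Y)=g(X,\varphi Y)$, and $$N_\varphi(X,Y)=[\varphi X,\varphi Y]+\varphi^2[X,Y]-\varphi[X,\varphi Y]-\varphi[\varphi X,Y]+d\eta(X,Y)\xi .$$ The structure is anti-quasi-Sasakian if $d\Phi=0$ and $N_\varphi=2\,d\eta\otimes\xi$; it is cokähler if $N_\varphi=0$, $d\eta=0$ and $d\Phi=0$. A homothetic deformation replaces $(\varphi,\xi,\eta,g)$ by $(\varphi,\frac1\lambda\xi,\lambda\eta,\lambda^2g)$ for some real $\lambda\neq0$ (the underlying Lie algebra is unchanged). $\mathfrak{h}_5$ is the $5$-dimensional Heisenberg Lie algebra: it has a basis $e_1,\dots,e_5$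 whose dual basis satisfies $de^1=de^2=de^3=de^4=0$, $de^5=e^1\wedge e^2+e^3\wedge e^4$. *)

theory Defs
  imports "HOL-Analysis.Analysis"
begin

definition lie_bracket :: "('a::real_vector \<Rightarrow> 'a \<Rightarrow> 'a) \<Rightarrow> bool" where
  "lie_bracket br \<longleftrightarrow>
     bilinear br \<and>
     (\<forall>x. br x x = 0) \<and>
     (\<forall>x y z. br x (br y z) + br y (br z x) + br z (br x y) = 0)"

definition lie_isomorphic ::
  "('a::real_vector \<Rightarrow> 'a \<Rightarrow> 'a) \<Rightarrow> ('b::real_vector \<Rightarrow> 'b \<Rightarrow> 'b) \<Rightarrow> bool" where
  "lie_isomorphic br br' \<longleftrightarrow>
     (\<exists>f. linear f \<and> bij f \<and> (\<forall>x y. f (br x y) = br' (f x) (f y)))"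

text \<open>The differential in degrees 1 and 2. No factor 1/2 or 1/3 appears, and
  the wedge product of 1-forms below is normalised accordingly.\<close>

definition ce_d1 :: "('a::real_vector \<Rightarrow> 'a \<Rightarrow> 'a) \<Rightarrow> ('a \<Rightarrow> real) \<Rightarrow> 'a \<Rightarrow> 'a \<Rightarrow> real" where
  "ce_d1 br \<alpha> x y = - \<alpha> (br x y)"

definition ce_d2 ::
  "('a::real_vector \<Rightarrow> 'a \<Rightarrow> 'a) \<Rightarrow> ('a \<Rightarrow> 'a \<Rightarrow> real) \<Rightarrow> 'a \<Rightarrow> 'a \<Rightarrow> 'a \<Rightarrow> real" where
  "ce_d2 br \<omega> x y z = - \<omega> (br x y) z + \<omega> (br x z) y - \<omega> (br y z) x"

definition wedge :: "('a \<Rightarrow> real) \<Rightarrow> ('a \<Rightarrow> real) \<Rightarrow> 'a \<Rightarrow> 'a \<Rightarrow> real" where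
  "wedge \<alpha> \<beta> x y = \<alpha> x * \<beta> y - \<alpha> y * \<beta> x"

definition pos_def_inner_product :: "('a::real_vector \<Rightarrow> 'a \<Rightarrow> real) \<Rightarrow> bool" where
  "pos_def_inner_product g \<longleftrightarrow>
     bilinear g \<and> (\<forall>x y. g x y = g y x) \<and> (\<forall>x. x \<noteq> 0 \<longrightarrow> g x x > 0)"

record 'a acm_data =
  br :: "'a \<Rightarrow> 'a \<Rightarrow> 'a"
  phi :: "'a \<Rightarrow> 'a"
  xi :: 'a
  eta :: "'a \<Rightarrow> real"
  met :: "'a \<Rightarrow> 'a \<Rightarrow> real"

text \<open>\<^term>\<open>dim UNIV\<close> is 0 for an infinite-dimensional space, so oddness also
  enforces finite dimension.\<close>

definition almost_contact_metric_lie_algebra :: "'a::real_vector acm_data \<Rightarrow> bool" where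
  "almost_contact_metric_lie_algebra S \<longleftrightarrow>
     odd (dim (UNIV :: 'a set)) \<and>
     lie_bracket (br S) \<and>
     linear (phi S) \<and>
     linear (eta S) \<and>
     pos_def_inner_product (met S) \<and>
     (\<forall>x. phi S (phi S x) = - x + eta S x *\<^sub>R xi S) \<and>
     eta S (xi S) = 1 \<and>
     (\<forall>x y. met S (phi S x) (phi S y) = met S x y - eta S x * eta S y)"

definition fundamental_form :: "'a acm_data \<Rightarrow> 'a \<Rightarrow> 'a \<Rightarrow> real" where
  "fundamental_form S x y = met S x (phi S y)"

definition nijenhuis :: "'a::real_vector acm_data \<Rightarrow> 'a \<Rightarrow> 'a \<Rightarrow> 'a" where
  "nijenhuis S x y =
     br S (phi S x) (phi S y) + phi S (phi S (br S x y))
     - phi S (br S x (phi S y)) - phi S (br S (phi S x) y)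
     + ce_d1 (br S) (eta S) x y *\<^sub>R xi S"

definition anti_quasi_sasakian :: "'a::real_vector acm_data \<Rightarrow> bool" where
  "anti_quasi_sasakian S \<longleftrightarrow>
     almost_contact_metric_lie_algebra S \<and>
     (\<forall>x y z. ce_d2 (br S) (fundamental_form S) x y z = 0) \<and>
     (\<forall>x y. nijenhuis S x y = (2 * ce_d1 (br S) (eta S) x y) *\<^sub>R xi S)"

definition cokaehler :: "'a::real_vector acm_data \<Rightarrow> bool" where
  "cokaehler S \<longleftrightarrow>
     almost_contact_metric_lie_algebra S \<and>
     (\<forall>x y. nijenhuis S x y = 0) \<and>
     (\<forall>x y. ce_d1 (br S) (eta S) x y = 0) \<and>
     (\<forall>x y z. ce_d2 (br S) (fundamental_form S) x y z = 0)"

definition homothetic_deformation :: "real \<Rightarrow> 'a::real_vector acm_data \<Rightarrow> 'a acm_data" where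
  "homothetic_deformation c S =
     S\<lparr>xi := (1 / c) *\<^sub>R xi S, eta := (\<lambda>x. c * eta S x), met := (\<lambda>x y. c\<^sup>2 * met S x y)\<rparr>"

text \<open>Realised on \<^typ>\<open>real^5\<close> with the standard basis; in the index type the
  numeral 5 denotes the same element as 0. The signs are those forced by the
  structure equations, so the bracket of the first two basis vectors is minus the
  fifth.\<close>

definition h5_bracket :: "real^5 \<Rightarrow> real^5 \<Rightarrow> real^5" where
  "h5_bracket x y = axis 5 (- (x$1 * y$2 - x$2 * y$1 + x$3 * y$4 - x$4 * y$3))"

lemma h5_structure_equations:
  "ce_d1 h5_bracket (\<lambda>x. x$1) = (\<lambda>x y. 0)"
  "ce_d1 h5_bracket (\<lambda>x. x$2) = (\<lambda>x y. 0)"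
  "ce_d1 h5_bracket (\<lambda>x. x$3) = (\<lambda>x y. 0)"
  "ce_d1 h5_bracket (\<lambda>x. x$4) = (\<lambda>x y. 0)"
  "ce_d1 h5_bracket (\<lambda>x. x$5) =
     (\<lambda>x y. wedge (\<lambda>x. x$1) (\<lambda>x. x$2) x y + wedge (\<lambda>x. x$3) (\<lambda>x. x$4) x y)"
  by (auto simp: fun_eq_iff ce_d1_def h5_bracket_def wedge_def axis_def)

lemma lie_bracket_h5: "lie_bracket h5_bracket"
  unfolding lie_bracket_def bilinear_def h5_bracket_def
  by (auto intro!: linearI simp: vec_eq_iff axis_def algebra_simps)

end

theory Submission
  imports Defs
begin

text \<open>Let \<open>H\<close> be the kernel of \<open>\<eta>\<close>. The form \<open>d\<eta>\<close> on \<open>H\<close> is \<open>\<phi>\<close>-anti-invariant and nonzero, so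
  with \<open>g\<close> and \<open>\<phi>\<close> it spans a hyperkaehler triple; by closedness and integrability the
  Levi-Civita connection of the horizontal bracket takes values in the commutant of that triple,
  i.e. in left multiplications by imaginary quaternions on \<open>H\<close>. Hence the bracket is
  \<open>[X, Y] = b(X) Y - b(Y) X - d\<eta>(X, Y) \<xi>\<close> and \<open>[\<xi>, X] = a X\<close> with \<open>b(X)\<close>, \<open>a\<close> imaginary
  quaternions. The Jacobi identity involving \<open>\<xi>\<close> gives \<open>b(a X) = [a, b(X)]\<close>; if \<open>a \<noteq> 0\<close> this forces
  \<open>b = 0\<close>, and the Jacobi identity on \<open>H\<close> then forces \<open>d\<eta> = 0\<close>. So \<open>a = 0\<close>. Since \<open>b\<close> maps four
  dimensions to three it has a kernel vector \<open>u\<close>; the Jacobi identity in the frame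
  \<open>u, i u, j u, k u\<close>, where \<open>b\<close> becomes a \<open>3 \<times> 3\<close> matrix, yields \<open>b = 0\<close> through sums of squares.
  What remains is the bracket of the Heisenberg algebra.\<close>

section \<open>Preliminaries, and the Jacobi identities in a quaternionic frame\<close>

lemma exhaust_5: "i = 1 \<or> i = 2 \<or> i = 3 \<or> i = 4 \<or> i = 5" for i :: 5
proof (induct i)
  case (of_int z)
  \<comment> \<open>Representatives run from 0 to 4, and 0 is the index written 5.\<close>
  then have "z = 0 \<or> z = 1 \<or> z = 2 \<or> z = 3 \<or> z = 4" by fastforce
  then show ?case by auto
qed

lemma lie_bracket_skew:
  assumes "lie_bracket lb"
  shows "lb y x = - lb x y"
proof -
  have bil: "bilinear lb" and alt: "\<And>x. lb x x = 0"
    using assms by (auto simp: lie_bracket_def)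
  have "lb x y + lb y x = lb (x + y) (x + y)"
    by (simp add: bilinear_ladd[OF bil] bilinear_radd[OF bil] alt[of x] alt[of y])
  then have "lb x y + lb y x = 0"
    by (simp only: alt)
  from minus_unique[OF this] show ?thesis
    by (rule sym)
qed

text \<open>The hypotheses say \<open>M a = 0\<close> and \<open>2 A M = M A\<close>, where \<open>A\<close> is the matrix of the cross product
  with \<open>a\<close>. They give \<open>a\<^sup>T M = 0\<close>, and then \<open>4 A\<^sup>2 M = M A\<^sup>2\<close> reads \<open>4 |a|\<^sup>2 M = |a|\<^sup>2 M\<close>.\<close>

lemma cross_relation_imp_zero:
  fixes a1 a2 a3 :: real
  assumes n: "a1\<^sup>2 + a2\<^sup>2 + a3\<^sup>2 \<noteq> 0"
    and ker: "m11 * a1 + m12 * a2 + m13 * a3 = 0"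
      "m21 * a1 + m22 * a2 + m23 * a3 = 0"
      "m31 * a1 + m32 * a2 + m33 * a3 = 0"
    and c1: "2 * (a2 * m31 - a3 * m21) = a3 * m12 - a2 * m13"
      "2 * (a3 * m11 - a1 * m31) = a3 * m22 - a2 * m23"
      "2 * (a1 * m21 - a2 * m11) = a3 * m32 - a2 * m33"
    and c2: "2 * (a2 * m32 - a3 * m22) = a1 * m13 - a3 * m11"
      "2 * (a3 * m12 - a1 * m32) = a1 * m23 - a3 * m21"
      "2 * (a1 * m22 - a2 * m12) = a1 * m33 - a3 * m31"
    and c3: "2 * (a2 * m33 - a3 * m23) = a2 * m11 - a1 * m12"
      "2 * (a3 * m13 - a1 * m33) = a2 * m21 - a1 * m22"
      "2 * (a1 * m23 - a2 * m13) = a2 * m31 - a1 * m32"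
  shows "m11 = 0 \<and> m12 = 0 \<and> m13 = 0 \<and> m21 = 0 \<and> m22 = 0 \<and> m23 = 0 \<and> m31 = 0 \<and> m32 = 0 \<and> m33 = 0"
proof -
  define v1 where "v1 = a1 * m11 + a2 * m21 + a3 * m31"
  define v2 where "v2 = a1 * m12 + a2 * m22 + a3 * m32"
  define v3 where "v3 = a1 * m13 + a2 * m23 + a3 * m33"
  have x: "v2 * a3 - v3 * a2 = 0" "v3 * a1 - v1 * a3 = 0" "v1 * a2 - v2 * a1 = 0"
    and y: "v1 * a1 + v2 * a2 + v3 * a3 = 0"
    unfolding v1_def v2_def v3_def using ker c1 c2 c3 by algebra+
  have "(a1\<^sup>2 + a2\<^sup>2 + a3\<^sup>2) * v1 = 0" "(a1\<^sup>2 + a2\<^sup>2 + a3\<^sup>2) * v2 = 0" "(a1\<^sup>2 + a2\<^sup>2 + a3\<^sup>2) * v3 = 0"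
    using x y by algebra+
  then have v: "v1 = 0" "v2 = 0" "v3 = 0" using n by auto
  note v' = v[unfolded v1_def v2_def v3_def]
  have "(a1\<^sup>2 + a2\<^sup>2 + a3\<^sup>2) * m11 = 0" "(a1\<^sup>2 + a2\<^sup>2 + a3\<^sup>2) * m21 = 0" "(a1\<^sup>2 + a2\<^sup>2 + a3\<^sup>2) * m31 = 0"
    "(a1\<^sup>2 + a2\<^sup>2 + a3\<^sup>2) * m12 = 0" "(a1\<^sup>2 + a2\<^sup>2 + a3\<^sup>2) * m22 = 0" "(a1\<^sup>2 + a2\<^sup>2 + a3\<^sup>2) * m32 = 0"
    "(a1\<^sup>2 + a2\<^sup>2 + a3\<^sup>2) * m13 = 0" "(a1\<^sup>2 + a2\<^sup>2 + a3\<^sup>2) * m23 = 0" "(a1\<^sup>2 + a2\<^sup>2 + a3\<^sup>2) * m33 = 0"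
    using v' ker c1 c2 c3 by algebra+
  then show ?thesis using n by simp
qed

text \<open>Here \<open>f0, f1, f2, f3\<close> stand for u, i u, j u, k u and \<open>z\<close> for
  the Reeb vector. Column j of the matrix \<open>m\<close> is the imaginary quaternion
  b(\<open>fj\<close>), with b(\<open>f0\<close>) = 0, and \<open>w\<close> collects the components
  along \<open>z\<close>. The functionals \<open>h0\<close> to \<open>h3\<close> kill
  \<open>z\<close> and turn the horizontal part of each Jacobi identity into four real polynomial
  equations.\<close>

lemma quaternionic_lie_bracket_frame:
  fixes lb :: "'a::real_vector \<Rightarrow> 'a \<Rightarrow> 'a"
  assumes lie: "lie_bracket lb"
    and h: "linear h0" "linear h1" "linear h2" "linear h3"
    and dual: "h0 f0 = (1::real)" "h0 f1 = 0" "h0 f2 = 0" "h0 f3 = 0" "h0 z = 0"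
      "h1 f0 = (0::real)" "h1 f1 = (1::real)" "h1 f2 = 0" "h1 f3 = 0" "h1 z = 0"
      "h2 f0 = (0::real)" "h2 f1 = 0" "h2 f2 = 1" "h2 f3 = 0" "h2 z = 0"
      "h3 f0 = (0::real)" "h3 f1 = 0" "h3 f2 = 0" "h3 f3 = 1" "h3 z = 0"
    and br01: "lb f0 f1 = w01 *\<^sub>R z - (m11 *\<^sub>R f1 + m21 *\<^sub>R f2 + m31 *\<^sub>R f3)"
    and br02: "lb f0 f2 = w02 *\<^sub>R z - (m12 *\<^sub>R f1 + m22 *\<^sub>R f2 + m32 *\<^sub>R f3)"
    and br03: "lb f0 f3 = w03 *\<^sub>R z - (m13 *\<^sub>R f1 + m23 *\<^sub>R f2 + m33 *\<^sub>R f3)"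
    and br12: "lb f1 f2 = w12 *\<^sub>R z + (m11 *\<^sub>R f3 - m21 *\<^sub>R f0 - m31 *\<^sub>R f1)
        - (- m12 *\<^sub>R f0 - m22 *\<^sub>R f3 + m32 *\<^sub>R f2)"
    and br13: "lb f1 f3 = w13 *\<^sub>R z + (- m11 *\<^sub>R f2 + m21 *\<^sub>R f1 - m31 *\<^sub>R f0)
        - (- m13 *\<^sub>R f0 - m23 *\<^sub>R f3 + m33 *\<^sub>R f2)"
    and br23: "lb f2 f3 = w23 *\<^sub>R z + (- m12 *\<^sub>R f2 + m22 *\<^sub>R f1 - m32 *\<^sub>R f0)
        - (m13 *\<^sub>R f3 - m23 *\<^sub>R f0 - m33 *\<^sub>R f1)"
    and brz0: "lb z f0 = a1 *\<^sub>R f1 + a2 *\<^sub>R f2 + a3 *\<^sub>R f3"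
    and brz1: "lb z f1 = - a1 *\<^sub>R f0 - a2 *\<^sub>R f3 + a3 *\<^sub>R f2"
    and brz2: "lb z f2 = a1 *\<^sub>R f3 - a2 *\<^sub>R f0 - a3 *\<^sub>R f1"
    and brz3: "lb z f3 = - a1 *\<^sub>R f2 + a2 *\<^sub>R f1 - a3 *\<^sub>R f0"
    and w: "\<not> (w01 = 0 \<and> w02 = 0 \<and> w03 = 0 \<and> w12 = 0 \<and> w13 = 0 \<and> w23 = 0)"
  shows "a1 = 0 \<and> a2 = 0 \<and> a3 = 0 \<and>
    m11 = 0 \<and> m12 = 0 \<and> m13 = 0 \<and> m21 = 0 \<and> m22 = 0 \<and> m23 = 0 \<and> m31 = 0 \<and> m32 = 0 \<and> m33 = 0"
proof -
  have bil: "bilinear lb" and alt: "lb x x = 0"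
    and jac: "lb x (lb y t) + lb y (lb t x) + lb t (lb x y) = 0" for x y t
    using lie by (auto simp: lie_bracket_def)
  note sk = lie_bracket_skew[OF lie]
  note brs = br01 br02 br03 br12 br13 br23 brz0 brz1 brz2 brz3
  note brs' = brs sk[of f1 f0] sk[of f2 f0] sk[of f3 f0] sk[of f2 f1] sk[of f3 f1] sk[of f3 f2]
    sk[of f0 z] sk[of f1 z] sk[of f2 z] sk[of f3 z] alt
  note lins = bilinear_radd[OF bil] bilinear_rsub[OF bil] bilinear_rmul[OF bil] bilinear_rneg[OF bil]
    h[THEN linear_add] h[THEN linear_diff] h[THEN linear_scale] h[THEN linear_neg]
  have hj: "h0 (lb x (lb y t)) + h0 (lb y (lb t x)) + h0 (lb t (lb x y)) = 0"
    "h1 (lb x (lb y t)) + h1 (lb y (lb t x)) + h1 (lb t (lb x y)) = 0"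
    "h2 (lb x (lb y t)) + h2 (lb y (lb t x)) + h2 (lb t (lb x y)) = 0"
    "h3 (lb x (lb y t)) + h3 (lb y (lb t x)) + h3 (lb t (lb x y)) = 0" for x y t
    using h by (simp_all only: jac linear_0 flip: linear_add)
  note simps = brs' lins dual real_scaleR_def mult_1_right mult_zero_right add_0_left add_0_right
    diff_0 diff_0_right minus_zero minus_minus
    h[THEN linear_0]
  \<comment> \<open>Four coordinates for each triple \<open>z, f0, fj\<close>: entries 1, 5, 9 are
    the real ones and give the rows of M a = 0; the imaginary ones give the columns of 2 A M = M
    A.\<close>
  note z0 = hj[of z f0 f1, simplified simps] hj[of z f0 f2, simplified simps]
    hj[of z f0 f3, simplified simps]
  have ker: "m11 * a1 + m12 * a2 + m13 * a3 = 0"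
      "m21 * a1 + m22 * a2 + m23 * a3 = 0"
      "m31 * a1 + m32 * a2 + m33 * a3 = 0"
    using z0(1) z0(5) z0(9) by algebra+
  have c1: "2 * (a2 * m31 - a3 * m21) = a3 * m12 - a2 * m13"
      "2 * (a3 * m11 - a1 * m31) = a3 * m22 - a2 * m23"
      "2 * (a1 * m21 - a2 * m11) = a3 * m32 - a2 * m33"
    using ker z0(2-4) by algebra+
  have c2: "2 * (a2 * m32 - a3 * m22) = a1 * m13 - a3 * m11"
      "2 * (a3 * m12 - a1 * m32) = a1 * m23 - a3 * m21"
      "2 * (a1 * m22 - a2 * m12) = a1 * m33 - a3 * m31"
    using ker z0(6-8) by algebra+
  have c3: "2 * (a2 * m33 - a3 * m23) = a2 * m11 - a1 * m12"
      "2 * (a3 * m13 - a1 * m33) = a2 * m21 - a1 * m22"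
      "2 * (a1 * m23 - a2 * m13) = a2 * m31 - a1 * m32"
    using ker z0(10-12) by algebra+
  note j012 = hj[of f0 f1 f2, simplified simps]
  note j031 = hj[of f0 f3 f1, simplified simps]
  note j023 = hj[of f0 f2 f3, simplified simps]
  note j123 = hj[of f1 f2 f3, simplified simps]
  have a: "a1 = 0 \<and> a2 = 0 \<and> a3 = 0"
  proof (rule ccontr)
    assume "\<not> ?thesis"
    then have n: "a1\<^sup>2 + a2\<^sup>2 + a3\<^sup>2 \<noteq> 0"
      by (metis add_nonneg_eq_0_iff add_nonneg_nonneg power_eq_0_iff zero_le_power2)
    from cross_relation_imp_zero[OF n ker c1 c2 c3]
    have m: "m11 = 0" "m12 = 0" "m13 = 0" "m21 = 0" "m22 = 0" "m23 = 0" "m31 = 0" "m32 = 0" "m33 = 0"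
      by auto
    \<comment> \<open>With M = 0 the Jacobi identity of \<open>f0, f1, f2\<close> says that the
      quaternion a annihilates w12 f0 - w02 f1 + w01 f2. The claim is the squared norm of that
      product; the other two triples are alike.\<close>
    have "(a1\<^sup>2 + a2\<^sup>2 + a3\<^sup>2) * (w01\<^sup>2 + w12\<^sup>2 + w02\<^sup>2) = 0"
      using j012 unfolding m by algebra
    moreover have "(a1\<^sup>2 + a2\<^sup>2 + a3\<^sup>2) * (w01\<^sup>2 + w13\<^sup>2 + w03\<^sup>2) = 0"
      using j031 unfolding m by algebra
    moreover have "(a1\<^sup>2 + a2\<^sup>2 + a3\<^sup>2) * (w02\<^sup>2 + w23\<^sup>2 + w03\<^sup>2) = 0"
      using j023 unfolding m by algebra
    ultimately show False
      using n w by (auto simp: add_nonneg_eq_0_iff)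
  qed
  have a': "a1 = 0" "a2 = 0" "a3 = 0" using a by auto
  txt \<open>The trace of the imaginary part of the Jacobi identities that involve \<open>f0\<close>.\<close>
  have "2 * (m11\<^sup>2 + m22\<^sup>2 + m33\<^sup>2) + ((m12 + m21)\<^sup>2 + (m13 + m31)\<^sup>2 + (m23 + m32)\<^sup>2) = 0"
    using j012(4) j031(3) j023(2) unfolding a' by algebra
  then have d: "m11 = 0" "m22 = 0" "m33 = 0" and o: "m12 = - m21" "m13 = - m31" "m23 = - m32"
    by (auto simp: add_nonneg_eq_0_iff eq_neg_iff_add_eq_0)
  \<comment> \<open>M is now skew, hence the cross product with a fixed vector. The real coordinate
    of the one remaining identity yields the squared length of that vector.\<close>
  have "m21\<^sup>2 + m31\<^sup>2 + m32\<^sup>2 = 0"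
    using j123(1) unfolding a' d o by algebra
  then show ?thesis
    using a d o by (auto simp: add_nonneg_eq_0_iff)
qed

section \<open>Linear algebra in a real vector space of known dimension\<close>

lemma exists_kernel_vector:
  fixes f :: "'a::real_vector \<Rightarrow> 'b::euclidean_space"
  assumes "linear f" and "DIM('b) < dim (UNIV :: 'a set)"
  shows "\<exists>x. x \<noteq> 0 \<and> f x = 0"
proof (rule ccontr)
  assume "\<not> ?thesis"
  then have inj: "inj f"
    using linear_injective_0[OF assms(1)] by auto
  obtain B where "B \<subseteq> (UNIV :: 'a set)" and B: "independent B" and "UNIV \<subseteq> span B"
    and cardB: "card B = dim (UNIV :: 'a set)"
    by (rule basis_exists)
  have "independent (f ` B)"
    using linear_independent_injective_image[OF assms(1) B] inj by (auto intro: inj_on_subset)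
  from independent_bound[OF this] have "card (f ` B) \<le> DIM('b)"
    by simp
  moreover have "card (f ` B) = card B"
    using inj by (intro card_image) (auto intro: inj_on_subset)
  ultimately show False
    using cardB assms(2) by simp
qed

text \<open>A vector outside the range, added to the image of \<open>Basis\<close>, would give one
  independent vector more than the dimension allows.\<close>

lemma linear_inj_imp_surj_dim:
  fixes f :: "'b::euclidean_space \<Rightarrow> 'a::real_vector"
  assumes "linear f" and "inj f" and "DIM('b) = dim (UNIV :: 'a set)"
  shows "surj f"
proof (rule ccontr)
  assume "\<not> surj f"
  moreover have "span (f ` Basis) = range f"
    using linear_span_image[OF assms(1), of Basis] by simp
  ultimately obtain x where x: "x \<notin> span (f ` Basis)"
    by blast
  have ind: "independent (f ` Basis)"
    using linear_independent_injective_image[OF assms(1) independent_Basis] assms(2)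
    by (auto intro: inj_on_subset)
  have card: "card (insert x (f ` Basis)) = Suc DIM('b)"
    using x assms(2) by (subst card_insert_disjoint) (auto intro: span_base simp: card_image inj_on_subset)
  obtain B where "B \<subseteq> (UNIV :: 'a set)" and "independent B" and spanB: "UNIV \<subseteq> span B"
    and cardB: "card B = dim (UNIV :: 'a set)"
    by (rule basis_exists)
  \<comment> \<open>An infinite set has cardinality 0, but \<open>card B\<close> is a positive
    dimension.\<close>
  have "finite B"
    using cardB assms(3) by (metis DIM_positive card.infinite less_irrefl)
  from independent_span_bound[OF this independent_insertI[OF x ind]] spanB cardB card assms(3)
  show False
    by auto
qed

text \<open>The coordinate functionals are the components of the inverse of the linear bijection
  sending coefficient tuples to combinations. The equivalence in the conclusion carries both the
  expansion of every vector and the uniqueness of its coefficients.\<close>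

lemma dual_basis_dim_5:
  fixes v0 v1 v2 v3 v4 :: "'a::real_vector"
  assumes dim: "dim (UNIV :: 'a set) = 5"
    and ind: "\<And>c0 c1 c2 c3 c4.
      c0 *\<^sub>R v0 + c1 *\<^sub>R v1 + c2 *\<^sub>R v2 + c3 *\<^sub>R v3 + c4 *\<^sub>R v4 = 0 \<Longrightarrow>
      c0 = 0 \<and> c1 = 0 \<and> c2 = 0 \<and> c3 = 0 \<and> c4 = 0"
  obtains h0 h1 h2 h3 h4 :: "'a \<Rightarrow> real"
  where "linear h0" "linear h1" "linear h2" "linear h3" "linear h4"
    and "\<forall>x c0 c1 c2 c3 c4.
      x = c0 *\<^sub>R v0 + c1 *\<^sub>R v1 + c2 *\<^sub>R v2 + c3 *\<^sub>R v3 + c4 *\<^sub>R v4 \<longleftrightarrow>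
      h0 x = c0 \<and> h1 x = c1 \<and> h2 x = c2 \<and> h3 x = c3 \<and> h4 x = c4"
proof -
  define T :: "real \<times> real \<times> real \<times> real \<times> real \<Rightarrow> 'a" where
    "T = (\<lambda>(c0, c1, c2, c3, c4).
      c0 *\<^sub>R v0 + c1 *\<^sub>R v1 + c2 *\<^sub>R v2 + c3 *\<^sub>R v3 + c4 *\<^sub>R v4)"
  have lin: "linear T"
    by (rule linearI) (auto simp: T_def algebra_simps)
  have inj: "inj T"
    unfolding linear_injective_0[OF lin] using ind by (auto simp: T_def zero_prod_def)
  have bij: "bij T"
    using linear_inj_imp_surj_dim[OF lin inj] inj dim by (simp add: bij_def)
  have inv: "linear (inv T)"
  proof (rule linearI)
    fix x y and c :: real
    have T: "T (inv T x) = x" for x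
      using bij by (simp add: bij_is_surj surj_f_inv_f)
    show "inv T (x + y) = inv T x + inv T y"
      by (rule inv_f_eq[OF inj]) (simp add: linear_add[OF lin] T)
    show "inv T (c *\<^sub>R x) = c *\<^sub>R inv T x"
      by (rule inv_f_eq[OF inj]) (simp add: linear_scale[OF lin] T)
  qed
  define h0 h1 h2 h3 h4 where h: "h0 = (\<lambda>x. fst (inv T x))" "h1 = (\<lambda>x. fst (snd (inv T x)))"
    "h2 = (\<lambda>x. fst (snd (snd (inv T x))))" "h3 = (\<lambda>x. fst (snd (snd (snd (inv T x)))))"
    "h4 = (\<lambda>x. snd (snd (snd (snd (inv T x)))))"
  show thesis
  proof (rule that)
    show "linear h0" "linear h1" "linear h2" "linear h3" "linear h4"
      unfolding h by (rule linearI; simp add: linear_add[OF inv] linear_scale[OF inv])+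
    have "x = T (c0, c1, c2, c3, c4) \<longleftrightarrow> inv T x = (c0, c1, c2, c3, c4)" for x c0 c1 c2 c3 c4
      using bij by (metis bij_inv_eq_iff)
    then show "\<forall>x c0 c1 c2 c3 c4. x = c0 *\<^sub>R v0 + c1 *\<^sub>R v1 + c2 *\<^sub>R v2 + c3 *\<^sub>R v3 + c4 *\<^sub>R v4 \<longleftrightarrow>
      h0 x = c0 \<and> h1 x = c1 \<and> h2 x = c2 \<and> h3 x = c3 \<and> h4 x = c4"
      by (auto simp: T_def h prod_eq_iff)
  qed
qed

section \<open>Lie brackets of quaternionic form\<close>

lemma quaternionic_lie_bracket:
  fixes lb :: "'a::real_vector \<Rightarrow> 'a \<Rightarrow> 'a" and \<eta> b1 b2 b3 :: "'a \<Rightarrow> real"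
  assumes lie: "lie_bracket lb" and dim: "dim (UNIV :: 'a set) = 5"
    and lin: "linear I" "linear J" "linear K" "linear b1" "linear b2" "linear b3" "linear \<eta>"
    and \<eta>: "\<eta> z = 1" "\<And>x. \<eta> (I x) = 0" "\<And>x. \<eta> (J x) = 0" "\<And>x. \<eta> (K x) = 0"
    and q: "\<And>x. \<eta> x = 0 \<Longrightarrow> I (I x) = - x" "\<And>x. \<eta> x = 0 \<Longrightarrow> J (J x) = - x"
      "\<And>x. \<eta> x = 0 \<Longrightarrow> K (K x) = - x" "\<And>x. \<eta> x = 0 \<Longrightarrow> I (J x) = K x"
      "\<And>x. \<eta> x = 0 \<Longrightarrow> J (I x) = - K x" "\<And>x. \<eta> x = 0 \<Longrightarrow> J (K x) = I x"
      "\<And>x. \<eta> x = 0 \<Longrightarrow> K (J x) = - I x" "\<And>x. \<eta> x = 0 \<Longrightarrow> K (I x) = J x"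
      "\<And>x. \<eta> x = 0 \<Longrightarrow> I (K x) = - J x"
    and lb: "\<And>x y. \<eta> x = 0 \<Longrightarrow> \<eta> y = 0 \<Longrightarrow> lb x y = \<eta> (lb x y) *\<^sub>R z
      + (b1 x *\<^sub>R I y + b2 x *\<^sub>R J y + b3 x *\<^sub>R K y) - (b1 y *\<^sub>R I x + b2 y *\<^sub>R J x + b3 y *\<^sub>R K x)"
    and lbz: "\<And>x. \<eta> x = 0 \<Longrightarrow> lb z x = a1 *\<^sub>R I x + a2 *\<^sub>R J x + a3 *\<^sub>R K x"
    and w: "\<eta> x0 = 0" "\<eta> y0 = 0" "\<eta> (lb x0 y0) \<noteq> 0"
  shows "\<eta> x = 0 \<Longrightarrow> lb z x = 0"
    and "\<eta> x = 0 \<Longrightarrow> \<eta> y = 0 \<Longrightarrow> lb x y = \<eta> (lb x y) *\<^sub>R z"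
proof -
  have bil: "bilinear lb" and alt: "\<And>x. lb x x = 0"
    using lie by (auto simp: lie_bracket_def)
  \<comment> \<open>Adding \<open>\<eta>\<close> as a fourth component makes the kernel vector
    horizontal; the map still drops from dimension 5 to 4.\<close>
  have "linear (\<lambda>x. (\<eta> x, b1 x, b2 x, b3 x))"
    by (rule linearI) (simp_all add: lin[THEN linear_add] lin[THEN linear_scale])
  from exists_kernel_vector[OF this] obtain u
    where u: "u \<noteq> 0" "\<eta> u = 0" "b1 u = 0" "b2 u = 0" "b3 u = 0"
    using dim by (auto simp: zero_prod_def)
  note qu = q[OF u(2)]
  note lins = lin[THEN linear_add] lin[THEN linear_scale] lin[THEN linear_neg] lin[THEN linear_diff]
  have ind: "c0 = 0 \<and> c1 = 0 \<and> c2 = 0 \<and> c3 = 0 \<and> c4 = 0"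
    if c: "c0 *\<^sub>R u + c1 *\<^sub>R I u + c2 *\<^sub>R J u + c3 *\<^sub>R K u + c4 *\<^sub>R z = 0" for c0 c1 c2 c3 c4
  proof -
    have "\<eta> (c0 *\<^sub>R u + c1 *\<^sub>R I u + c2 *\<^sub>R J u + c3 *\<^sub>R K u + c4 *\<^sub>R z) = 0"
      unfolding c using lin(7) by (rule linear_0)
    then have c4: "c4 = 0"
      by (simp add: lins \<eta> u)
    define x where "x = c0 *\<^sub>R u + c1 *\<^sub>R I u + c2 *\<^sub>R J u + c3 *\<^sub>R K u"
    have "x = 0"
      using c by (simp add: x_def c4)
    \<comment> \<open>Here x is a quaternion applied to u; applying its conjugate returns the
      squared norm of the quaternion times u.\<close>
    moreover have "c0 *\<^sub>R x - c1 *\<^sub>R I x - c2 *\<^sub>R J x - c3 *\<^sub>R K x = (c0\<^sup>2 + c1\<^sup>2 + c2\<^sup>2 + c3\<^sup>2) *\<^sub>R u"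
      by (simp add: x_def lins qu algebra_simps power2_eq_square)
    ultimately have "c0\<^sup>2 + c1\<^sup>2 + c2\<^sup>2 + c3\<^sup>2 = 0"
      using u(1) by (simp add: lin[THEN linear_0])
    then show ?thesis
      using c4 by (auto simp: add_nonneg_eq_0_iff)
  qed
  obtain h0 h1 h2 h3 h4 where h: "linear h0" "linear h1" "linear h2" "linear h3" "linear h4"
    and coord: "\<forall>x c0 c1 c2 c3 c4.
      x = c0 *\<^sub>R u + c1 *\<^sub>R I u + c2 *\<^sub>R J u + c3 *\<^sub>R K u + c4 *\<^sub>R z \<longleftrightarrow>
      h0 x = c0 \<and> h1 x = c1 \<and> h2 x = c2 \<and> h3 x = c3 \<and> h4 x = c4"
    by (rule dual_basis_dim_5[OF dim ind])
  have dual: "h0 u = 1" "h0 (I u) = 0" "h0 (J u) = 0" "h0 (K u) = 0" "h0 z = 0"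
      "h1 u = 0" "h1 (I u) = 1" "h1 (J u) = 0" "h1 (K u) = 0" "h1 z = 0"
      "h2 u = 0" "h2 (I u) = 0" "h2 (J u) = 1" "h2 (K u) = 0" "h2 z = 0"
      "h3 u = 0" "h3 (I u) = 0" "h3 (J u) = 0" "h3 (K u) = 1" "h3 z = 0"
    using coord[rule_format, of u 1 0 0 0 0] coord[rule_format, of "I u" 0 1 0 0 0]
      coord[rule_format, of "J u" 0 0 1 0 0] coord[rule_format, of "K u" 0 0 0 1 0]
      coord[rule_format, of z 0 0 0 0 1] by auto
  have ex: "x = h0 x *\<^sub>R u + h1 x *\<^sub>R I u + h2 x *\<^sub>R J u + h3 x *\<^sub>R K u" if "\<eta> x = 0" for x
  proof -
    have *: "x = h0 x *\<^sub>R u + h1 x *\<^sub>R I u + h2 x *\<^sub>R J u + h3 x *\<^sub>R K u + h4 x *\<^sub>R z"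
      using coord by blast
    from arg_cong[OF *, of \<eta>] have "h4 x = 0"
      using that by (simp add: lins \<eta> u)
    with * show ?thesis by simp
  qed
  have nz: "\<not> (\<eta> (lb u (I u)) = 0 \<and> \<eta> (lb u (J u)) = 0 \<and> \<eta> (lb u (K u)) = 0 \<and>
      \<eta> (lb (I u) (J u)) = 0 \<and> \<eta> (lb (I u) (K u)) = 0 \<and> \<eta> (lb (J u) (K u)) = 0)"
  proof
    assume 0: "\<eta> (lb u (I u)) = 0 \<and> \<eta> (lb u (J u)) = 0 \<and> \<eta> (lb u (K u)) = 0 \<and>
      \<eta> (lb (I u) (J u)) = 0 \<and> \<eta> (lb (I u) (K u)) = 0 \<and> \<eta> (lb (J u) (K u)) = 0"
    have sk: "\<eta> (lb y x) = - \<eta> (lb x y)" for x y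
      using lie_bracket_skew[OF lie, of x y] by (simp add: lins)
    have "\<eta> (lb x0 y0) = 0"
      by (subst ex[OF w(1)], subst ex[OF w(2)])
        (simp add: bilinear_ladd[OF bil] bilinear_radd[OF bil] bilinear_lmul[OF bil]
          bilinear_rmul[OF bil] lins 0 alt sk[where x = u and y = "I u"]
          sk[where x = u and y = "J u"] sk[where x = u and y = "K u"]
          sk[where x = "I u" and y = "J u"] sk[where x = "I u" and y = "K u"]
          sk[where x = "J u" and y = "K u"] linear_0[OF lin(7)])
    with w(3) show False by simp
  qed
  have van: "a1 = 0 \<and> a2 = 0 \<and> a3 = 0 \<and>
    b1 (I u) = 0 \<and> b1 (J u) = 0 \<and> b1 (K u) = 0 \<and> b2 (I u) = 0 \<and> b2 (J u) = 0 \<and> b2 (K u) = 0 \<and>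
    b3 (I u) = 0 \<and> b3 (J u) = 0 \<and> b3 (K u) = 0"
  proof (rule quaternionic_lie_bracket_frame[OF lie h(1-4) dual _ _ _ _ _ _ _ _ _ _ nz])
    show "lb u (I u) = \<eta> (lb u (I u)) *\<^sub>R z - (b1 (I u) *\<^sub>R I u + b2 (I u) *\<^sub>R J u + b3 (I u) *\<^sub>R K u)"
      "lb u (J u) = \<eta> (lb u (J u)) *\<^sub>R z - (b1 (J u) *\<^sub>R I u + b2 (J u) *\<^sub>R J u + b3 (J u) *\<^sub>R K u)"
      "lb u (K u) = \<eta> (lb u (K u)) *\<^sub>R z - (b1 (K u) *\<^sub>R I u + b2 (K u) *\<^sub>R J u + b3 (K u) *\<^sub>R K u)"
      by (subst lb; simp add: u \<eta>)+
    show "lb (I u) (J u) = \<eta> (lb (I u) (J u)) *\<^sub>R z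
        + (b1 (I u) *\<^sub>R K u - b2 (I u) *\<^sub>R u - b3 (I u) *\<^sub>R I u)
        - (- b1 (J u) *\<^sub>R u - b2 (J u) *\<^sub>R K u + b3 (J u) *\<^sub>R J u)"
      "lb (I u) (K u) = \<eta> (lb (I u) (K u)) *\<^sub>R z
        + (- b1 (I u) *\<^sub>R J u + b2 (I u) *\<^sub>R I u - b3 (I u) *\<^sub>R u)
        - (- b1 (K u) *\<^sub>R u - b2 (K u) *\<^sub>R K u + b3 (K u) *\<^sub>R J u)"
      "lb (J u) (K u) = \<eta> (lb (J u) (K u)) *\<^sub>R z
        + (- b1 (J u) *\<^sub>R J u + b2 (J u) *\<^sub>R I u - b3 (J u) *\<^sub>R u)
        - (b1 (K u) *\<^sub>R K u - b2 (K u) *\<^sub>R u - b3 (K u) *\<^sub>R I u)"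
      by (subst lb; simp add: u \<eta> qu)+
    show "lb z u = a1 *\<^sub>R I u + a2 *\<^sub>R J u + a3 *\<^sub>R K u"
      "lb z (I u) = - a1 *\<^sub>R u - a2 *\<^sub>R K u + a3 *\<^sub>R J u"
      "lb z (J u) = a1 *\<^sub>R K u - a2 *\<^sub>R u - a3 *\<^sub>R I u"
      "lb z (K u) = - a1 *\<^sub>R J u + a2 *\<^sub>R I u - a3 *\<^sub>R u"
      by (simp_all add: lbz u \<eta> qu)
  qed
  have b: "b1 x = 0 \<and> b2 x = 0 \<and> b3 x = 0" if "\<eta> x = 0" for x
    by (subst (1 2 3) ex[OF that]) (simp add: lins u van)
  show "\<eta> x = 0 \<Longrightarrow> lb z x = 0"
    by (simp add: lbz van)
  show "\<eta> x = 0 \<Longrightarrow> \<eta> y = 0 \<Longrightarrow> lb x y = \<eta> (lb x y) *\<^sub>R z"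
    by (subst lb) (simp_all add: b)
qed

section \<open>Consequences of the anti-quasi-Sasakian identities\<close>

locale anti_quasi_sasakian_algebra =
  fixes S :: "'a::real_vector acm_data"
  assumes anti_quasi_sasakian: "anti_quasi_sasakian S"
begin

abbreviation lb where "lb \<equiv> br S"
abbreviation \<phi> where "\<phi> \<equiv> phi S"
abbreviation \<xi> where "\<xi> \<equiv> xi S"
abbreviation \<eta> where "\<eta> \<equiv> eta S"
abbreviation g where "g \<equiv> met S"

lemma lie: "lie_bracket lb"
  and linear_phi: "linear \<phi>"
  and linear_eta: "linear \<eta>"
  and bilinear_g: "bilinear g"
  and g_commute: "g x y = g y x"
  and g_pos: "x \<noteq> 0 \<Longrightarrow> g x x > 0"
  and phi_phi: "\<phi> (\<phi> x) = - x + \<eta> x *\<^sub>R \<xi>"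
  and eta_xi: "\<eta> \<xi> = 1"
  and g_phi_phi: "g (\<phi> x) (\<phi> y) = g x y - \<eta> x * \<eta> y"
  using anti_quasi_sasakian
  by (auto simp: anti_quasi_sasakian_def almost_contact_metric_lie_algebra_def
      pos_def_inner_product_def)

lemma bilinear_lb: "bilinear lb"
  and lb_self: "lb x x = 0"
  and jacobi: "lb x (lb y z) + lb y (lb z x) + lb z (lb x y) = 0"
  using lie by (auto simp: lie_bracket_def)

lemmas lb_skew = lie_bracket_skew[OF lie]

lemmas lb_simps = bilinear_ladd[OF bilinear_lb] bilinear_radd[OF bilinear_lb]
  bilinear_lmul[OF bilinear_lb] bilinear_rmul[OF bilinear_lb]
  bilinear_lneg[OF bilinear_lb] bilinear_rneg[OF bilinear_lb]
  bilinear_lsub[OF bilinear_lb] bilinear_rsub[OF bilinear_lb]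
  bilinear_lzero[OF bilinear_lb] bilinear_rzero[OF bilinear_lb] lb_self

lemmas g_simps = bilinear_ladd[OF bilinear_g] bilinear_radd[OF bilinear_g]
  bilinear_lmul[OF bilinear_g] bilinear_rmul[OF bilinear_g]
  bilinear_lneg[OF bilinear_g] bilinear_rneg[OF bilinear_g]
  bilinear_lsub[OF bilinear_g] bilinear_rsub[OF bilinear_g]
  bilinear_lzero[OF bilinear_g] bilinear_rzero[OF bilinear_g]

lemmas eta_simps = linear_add[OF linear_eta] linear_diff[OF linear_eta] linear_scale[OF linear_eta]
  linear_neg[OF linear_eta] linear_0[OF linear_eta] eta_xi

lemmas phi_simps = linear_add[OF linear_phi] linear_diff[OF linear_phi] linear_scale[OF linear_phi]
  linear_neg[OF linear_phi] linear_0[OF linear_phi]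

lemma xi_nonzero: "\<xi> \<noteq> 0"
  using eta_xi linear_0[OF linear_eta] by auto

text \<open>Since \<open>\<phi> (\<phi> \<xi>)\<close> vanishes, a third application of
  \<open>\<phi>\<close> shows that \<open>\<phi> \<xi>\<close> is c times \<open>\<xi>\<close>. Then
  \<open>\<phi> (\<phi> \<xi>)\<close> is c squared times \<open>\<xi>\<close>, so c = 0.\<close>

lemma phi_xi: "\<phi> \<xi> = 0"
proof -
  have "\<phi> (\<phi> (\<phi> \<xi>)) = 0"
    by (simp only: phi_phi[of \<xi>] eta_xi) (simp add: phi_simps)
  then have *: "\<phi> \<xi> = \<eta> (\<phi> \<xi>) *\<^sub>R \<xi>"
    using phi_phi[of "\<phi> \<xi>"] by simp
  have "\<phi> (\<phi> \<xi>) = (\<eta> (\<phi> \<xi>) * \<eta> (\<phi> \<xi>)) *\<^sub>R \<xi>"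
    by (metis * linear_scale[OF linear_phi] scaleR_scaleR)
  then have "\<eta> (\<phi> \<xi>) = 0"
    using xi_nonzero by (simp add: phi_phi eta_xi)
  with * show ?thesis by simp
qed

lemma eta_phi: "\<eta> (\<phi> x) = 0"
proof -
  have "\<phi> (\<phi> (\<phi> x)) = - \<phi> x"
    by (simp only: phi_phi[of x]) (simp add: phi_simps phi_xi)
  then show ?thesis
    using xi_nonzero phi_phi[of "\<phi> x"] by simp
qed

lemma g_xi: "g x \<xi> = \<eta> x" "g \<xi> x = \<eta> x"
proof -
  show "g x \<xi> = \<eta> x"
    using g_phi_phi[of x \<xi>] by (simp add: phi_xi g_simps eta_xi)
  then show "g \<xi> x = \<eta> x"
    by (simp add: g_commute)
qed

lemma g_phi_left: "g (\<phi> x) y = - g x (\<phi> y)"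
  using g_phi_phi[of x "\<phi> y"] by (simp add: phi_phi g_simps g_xi eta_phi)

text \<open>The Nijenhuis tensor already contains one of the two copies of the differential of
  \<open>\<eta>\<close> on the right; cancelling it leaves the other.\<close>

lemma nijenhuis_eq:
  "lb (\<phi> x) (\<phi> y) + \<phi> (\<phi> (lb x y)) - \<phi> (lb x (\<phi> y)) - \<phi> (lb (\<phi> x) y) = - \<eta> (lb x y) *\<^sub>R \<xi>"
proof -
  have "nijenhuis S x y = (2 * ce_d1 lb \<eta> x y) *\<^sub>R \<xi>"
    using anti_quasi_sasakian by (simp add: anti_quasi_sasakian_def)
  moreover have "(2 * t) *\<^sub>R \<xi> = t *\<^sub>R \<xi> + t *\<^sub>R \<xi>" for t
    by (simp only: mult_2 scaleR_add_left)
  ultimately show ?thesis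
    by (simp only: nijenhuis_def ce_d1_def add_right_cancel)
qed

text \<open>\<open>\<eta>\<close> kills every image of \<open>\<phi>\<close>, so only two terms of
  the previous identity survive.\<close>

lemma eta_lb_phi: "\<eta> (lb (\<phi> x) (\<phi> y)) = - \<eta> (lb x y)"
  using arg_cong[OF nijenhuis_eq[of x y], of \<eta>] by (simp add: eta_simps eta_phi)

lemma eta_lb_xi: "\<eta> (lb x \<xi>) = 0" "\<eta> (lb \<xi> x) = 0"
proof -
  show "\<eta> (lb x \<xi>) = 0"
    using eta_lb_phi[of x \<xi>] by (simp add: phi_xi lb_simps eta_simps)
  then show "\<eta> (lb \<xi> x) = 0"
    by (simp add: lb_skew[of x \<xi>] eta_simps)
qed

lemma nijenhuis_g:
  assumes "\<eta> e = 0"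
  shows "g (lb (\<phi> x) (\<phi> y)) e - g (lb x y) e + g (lb x (\<phi> y)) (\<phi> e) + g (lb (\<phi> x) y) (\<phi> e) = 0"
  using arg_cong[OF nijenhuis_eq[of x y], of "\<lambda>v. g v e"] assms
  by (simp add: phi_phi g_simps g_phi_left g_xi)

lemma fundamental_closed:
  "g (lb x y) (\<phi> z) - g (lb x z) (\<phi> y) + g (lb y z) (\<phi> x) = 0"
proof -
  have "ce_d2 lb (fundamental_form S) x y z = 0"
    using anti_quasi_sasakian by (simp add: anti_quasi_sasakian_def)
  then show ?thesis
    by (simp add: ce_d2_def fundamental_form_def)
qed

text \<open>This is d(d eta) = 0. In the adapted frame it supplies the closedness of a second 2-form
  beside the fundamental one.\<close>

lemma eta_closed: "\<eta> (lb (lb x y) z) + \<eta> (lb (lb y z) x) + \<eta> (lb (lb z x) y) = 0"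
proof -
  have "\<eta> (lb z (lb x y) + lb x (lb y z) + lb y (lb z x)) = 0"
    by (simp add: jacobi eta_simps)
  then show ?thesis
    by (simp add: eta_simps lb_skew[of _ "lb _ _"])
qed

text \<open>As \<open>\<phi> \<xi> = 0\<close>, the Nijenhuis identity at \<open>\<xi>\<close> is
  this equation with \<open>\<phi>\<close> applied to both sides, and \<open>\<phi>\<close> is
  injective on horizontal vectors.\<close>

lemma lb_xi_phi: "lb \<xi> (\<phi> x) = \<phi> (lb \<xi> x)"
proof -
  have "\<phi> (\<phi> (lb \<xi> x)) = \<phi> (lb \<xi> (\<phi> x))"
    using nijenhuis_eq[of \<xi> x] by (simp add: phi_xi lb_simps eta_lb_xi phi_simps)
  from arg_cong[OF this, of \<phi>] show ?thesis
    by (simp add: phi_phi eta_phi eta_lb_xi phi_simps)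
qed

text \<open>Closedness of the fundamental form makes ad xi skew for that form; commuting with
  \<open>\<phi>\<close> turns this into skewness for \<open>g\<close>.\<close>

lemma lb_xi_skew:
  assumes "\<eta> y = 0"
  shows "g (lb \<xi> x) y = - g (lb \<xi> y) x"
proof -
  have "g (lb \<xi> x) (\<phi> (\<phi> y)) = - g (lb \<xi> (\<phi> (\<phi> y))) x"
    using fundamental_closed[of \<xi> x "\<phi> y"]
    by (simp add: phi_xi g_simps lb_xi_phi[of "\<phi> y"] g_phi_left[of "lb \<xi> (\<phi> y)"])
  then show ?thesis
    by (simp add: phi_phi assms g_simps lb_simps)
qed

lemma normalize:
  assumes "x \<noteq> 0" and "\<eta> x = 0"
  obtains e c where "x = c *\<^sub>R e" "\<eta> e = 0" "g e e = 1"
proof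
  have "g x x > 0" using g_pos assms(1) .
  then show "x = sqrt (g x x) *\<^sub>R ((1 / sqrt (g x x)) *\<^sub>R x)"
    "g ((1 / sqrt (g x x)) *\<^sub>R x) ((1 / sqrt (g x x)) *\<^sub>R x) = 1"
    using assms(1) by (auto simp: g_simps)
  show "\<eta> ((1 / sqrt (g x x)) *\<^sub>R x) = 0"
    by (simp add: eta_simps assms)
qed

lemma eta_lb_phi_self: "\<eta> (lb x (\<phi> x)) = 0"
  using eta_lb_phi[of x "\<phi> x"] lb_skew[of "\<phi> x" x]
  by (simp add: phi_phi lb_simps eta_simps eta_lb_xi)

lemma exists_adapted_frame:
  assumes "\<eta> (lb x y) \<noteq> 0"
  obtains e1 e2 where "\<eta> e1 = 0" "\<eta> e2 = 0" "g e1 e1 = 1" "g e2 e2 = 1" "g e1 e2 = 0"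
    "g e1 (\<phi> e2) = 0" "\<eta> (lb e1 (\<phi> e2)) = 0" "\<eta> (lb e1 e2) \<noteq> 0"
proof -
  define x' where "x' = x - \<eta> x *\<^sub>R \<xi>"
  have "\<eta> (lb x' y) \<noteq> 0"
    using assms by (simp add: x'_def lb_simps eta_simps eta_lb_xi)
  moreover have "\<eta> x' = 0"
    by (simp add: x'_def eta_simps)
  moreover have "x' \<noteq> 0"
    using calculation(1) by (auto simp: lb_simps eta_simps)
  ultimately obtain e1 c where "x' = c *\<^sub>R e1" and e1: "\<eta> e1 = 0" "g e1 e1 = 1"
    using normalize by metis
  with \<open>\<eta> (lb x' y) \<noteq> 0\<close> have e1y: "\<eta> (lb e1 y) \<noteq> 0"
    by (auto simp: lb_simps eta_simps)
  have e1\<phi>: "g (\<phi> e1) e1 = 0" "g e1 (\<phi> e1) = 0"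
    using g_phi_left[of e1 e1] g_commute[of e1 "\<phi> e1"] by simp_all
  \<comment> \<open>The subtracted directions pair to zero with \<open>e1\<close> under d eta, so
    the nonzero pairing of \<open>y\<close> with \<open>e1\<close> survives the
    orthogonalisation.\<close>
  define y' where "y' = y - \<eta> y *\<^sub>R \<xi> - g y e1 *\<^sub>R e1 - g y (\<phi> e1) *\<^sub>R \<phi> e1"
  have y'0: "\<eta> (lb e1 y') \<noteq> 0"
    using e1y by (simp add: y'_def lb_simps eta_simps eta_lb_xi eta_lb_phi_self)
  have y': "\<eta> y' = 0" "g e1 y' = 0" "g e1 (\<phi> y') = 0"
    using e1 e1\<phi> by (simp_all add: g_commute[of e1 y'] y'_def eta_simps eta_phi g_simps g_xi phi_simps
      phi_xi phi_phi g_commute[of e1 y] g_phi_left[of y e1] g_commute[of e1 "\<phi> y"])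
  txt \<open>Within the complex line of \<open>y'\<close> choose \<open>v\<close> so that \<open>\<phi> v\<close> pairs to zero with \<open>e1\<close>.\<close>
  define p where "p = \<eta> (lb e1 y')"
  define q where "q = \<eta> (lb e1 (\<phi> y'))"
  define v where "v = p *\<^sub>R y' + q *\<^sub>R \<phi> y'"
  have v: "\<eta> v = 0" "g e1 v = 0" "g e1 (\<phi> v) = 0" "\<eta> (lb e1 (\<phi> v)) = 0"
    using y' by (simp_all add: v_def eta_simps eta_phi g_simps phi_simps phi_phi lb_simps p_def q_def)
  have "p * p + q * q \<noteq> 0"
    using y'0 by (simp add: p_def)
  then have v0: "\<eta> (lb e1 v) \<noteq> 0"
    by (simp add: v_def eta_simps lb_simps flip: p_def q_def)
  then have "v \<noteq> 0"
    by (auto simp: lb_simps eta_simps)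
  then obtain e2 d where d: "v = d *\<^sub>R e2" and e2: "\<eta> e2 = 0" "g e2 e2 = 1"
    using normalize v(1) by metis
  have "d \<noteq> 0"
    using d \<open>v \<noteq> 0\<close> by auto
  show thesis
    by (rule that[OF e1(1) e2(1) e1(2) e2(2)])
      (use v v0 \<open>d \<noteq> 0\<close> in \<open>simp_all add: d g_simps eta_simps lb_simps phi_simps\<close>)
qed

end

section \<open>The quaternionic form of the bracket in an adapted frame\<close>

locale adapted_frame = anti_quasi_sasakian_algebra S for S :: "'a::real_vector acm_data" +
  fixes e1 e2 :: 'a
  assumes dim: "dim (UNIV :: 'a set) = 5"
    and eta_e1: "\<eta> e1 = 0" and eta_e2: "\<eta> e2 = 0"
    and g11: "g e1 e1 = 1" and g22: "g e2 e2 = 1" and g12: "g e1 e2 = 0"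
    and g1\<phi>2: "g e1 (\<phi> e2) = 0"
    and eta_lb_1\<phi>2: "\<eta> (lb e1 (\<phi> e2)) = 0"
    and eta_lb_12: "\<eta> (lb e1 e2) \<noteq> 0"
begin

definition "e3 = \<phi> e1"
definition "e4 = \<phi> e2"
definition "p = \<eta> (lb e1 e2)"

lemma p_nonzero: "p \<noteq> 0"
  using eta_lb_12 by (simp add: p_def)

lemma phi_e: "\<phi> e1 = e3" "\<phi> e2 = e4" "\<phi> e3 = - e1" "\<phi> e4 = - e2"
  by (simp_all add: e3_def e4_def phi_phi eta_e1 eta_e2)

lemma eta_e: "\<eta> e1 = 0" "\<eta> e2 = 0" "\<eta> e3 = 0" "\<eta> e4 = 0"
  by (simp_all add: eta_e1 eta_e2 e3_def e4_def eta_phi)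

lemma orthonormal:
  "g e1 e1 = 1" "g e2 e2 = 1" "g e3 e3 = 1" "g e4 e4 = 1"
  "g e1 e2 = 0" "g e1 e3 = 0" "g e1 e4 = 0" "g e2 e3 = 0" "g e2 e4 = 0" "g e3 e4 = 0"
  "g e2 e1 = 0" "g e3 e1 = 0" "g e4 e1 = 0" "g e3 e2 = 0" "g e4 e2 = 0" "g e4 e3 = 0"
proof -
  have self: "g x (\<phi> x) = 0" for x
    using g_phi_left[of x x] g_commute[of x "\<phi> x"] by simp
  show 1: "g e1 e1 = 1" "g e2 e2 = 1" "g e3 e3 = 1" "g e4 e4 = 1"
    "g e1 e2 = 0" "g e1 e3 = 0" "g e1 e4 = 0" "g e2 e4 = 0" "g e3 e4 = 0"
    by (simp_all add: e3_def e4_def g_phi_phi eta_e1 eta_e2 g11 g22 g12 g1\<phi>2 self)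
  show 2: "g e2 e3 = 0"
    using g_phi_left[of e2 e1] g1\<phi>2 by (simp add: e3_def g_commute[of "\<phi> e2" e1])
  show "g e2 e1 = 0" "g e3 e1 = 0" "g e4 e1 = 0" "g e3 e2 = 0" "g e4 e2 = 0" "g e4 e3 = 0"
    using 1 2 by (simp_all add: g_commute)
qed

lemma frame_expansion:
  "x = g x e1 *\<^sub>R e1 + g x e2 *\<^sub>R e2 + g x e3 *\<^sub>R e3 + g x e4 *\<^sub>R e4 + \<eta> x *\<^sub>R \<xi>"
proof -
  have coeff: "g y e1 = c1 \<and> g y e2 = c2 \<and> g y e3 = c3 \<and> g y e4 = c4 \<and> \<eta> y = c5"
    if "y = c1 *\<^sub>R e1 + c2 *\<^sub>R e2 + c3 *\<^sub>R e3 + c4 *\<^sub>R e4 + c5 *\<^sub>R \<xi>" for y c1 c2 c3 c4 c5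
    unfolding that by (simp add: g_simps eta_simps orthonormal g_xi eta_e)
  have "c1 = 0 \<and> c2 = 0 \<and> c3 = 0 \<and> c4 = 0 \<and> c5 = 0"
    if "c1 *\<^sub>R e1 + c2 *\<^sub>R e2 + c3 *\<^sub>R e3 + c4 *\<^sub>R e4 + c5 *\<^sub>R \<xi> = 0" for c1 c2 c3 c4 c5
    using coeff[OF that[symmetric]] by (simp add: g_simps eta_simps)
  then obtain h1 h2 h3 h4 h5 where
    "\<forall>x c1 c2 c3 c4 c5. x = c1 *\<^sub>R e1 + c2 *\<^sub>R e2 + c3 *\<^sub>R e3 + c4 *\<^sub>R e4 + c5 *\<^sub>R \<xi> \<longleftrightarrow>
      h1 x = c1 \<and> h2 x = c2 \<and> h3 x = c3 \<and> h4 x = c4 \<and> h5 x = c5"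
    by (rule dual_basis_dim_5[OF dim])
  then have x: "x = h1 x *\<^sub>R e1 + h2 x *\<^sub>R e2 + h3 x *\<^sub>R e3 + h4 x *\<^sub>R e4 + h5 x *\<^sub>R \<xi>"
    by blast
  have "h1 x = g x e1" "h2 x = g x e2" "h3 x = g x e3" "h4 x = g x e4" "h5 x = \<eta> x"
    using coeff[OF x] by simp_all
  from x[unfolded this] show ?thesis .
qed

lemma vector_eqI:
  assumes "g x e1 = g y e1" "g x e2 = g y e2" "g x e3 = g y e3" "g x e4 = g y e4" "\<eta> x = \<eta> y"
  shows "x = y"
  by (subst frame_expansion[of x], subst frame_expansion[of y]) (simp add: assms)

text \<open>Anti-invariance under \<open>\<phi>\<close> ties the pair 34 to 12 and 23 to 14. The
  pairs 13 and 24 have the form x, \<open>\<phi> x\<close>, and 14 vanishes by the choice of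
  frame.\<close>

lemma eta_lb_e:
  "\<eta> (lb e1 e2) = p" "\<eta> (lb e1 e3) = 0" "\<eta> (lb e1 e4) = 0"
  "\<eta> (lb e2 e3) = 0" "\<eta> (lb e2 e4) = 0" "\<eta> (lb e3 e4) = - p"
proof -
  show 1: "\<eta> (lb e1 e2) = p" "\<eta> (lb e1 e3) = 0" "\<eta> (lb e1 e4) = 0" "\<eta> (lb e2 e4) = 0"
    using eta_lb_1\<phi>2 by (simp_all add: p_def e3_def e4_def eta_lb_phi_self)
  show "\<eta> (lb e3 e4) = - p"
    by (simp add: e3_def e4_def eta_lb_phi p_def)
  show "\<eta> (lb e2 e3) = 0"
    using eta_lb_phi[of e1 e4] 1 lb_skew[of e2 e3] by (simp add: phi_e lb_simps eta_simps)
qed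

lemma lb_e_skew:
  "lb e2 e1 = - lb e1 e2" "lb e3 e1 = - lb e1 e3" "lb e4 e1 = - lb e1 e4"
  "lb e3 e2 = - lb e2 e3" "lb e4 e2 = - lb e2 e4" "lb e4 e3 = - lb e3 e4"
  by (rule lb_skew)+

lemma eta_lb_frame:
  "\<eta> (lb x e1) = - p * g x e2" "\<eta> (lb x e2) = p * g x e1"
  "\<eta> (lb x e3) = p * g x e4" "\<eta> (lb x e4) = - p * g x e3"
  by (subst frame_expansion[of x],
      simp add: lb_simps eta_simps lb_e_skew eta_lb_e eta_lb_xi)+

lemma eta_lb:
  "\<eta> (lb x y) = p * (g x e1 * g y e2 - g x e2 * g y e1 - g x e3 * g y e4 + g x e4 * g y e3)"
  by (subst frame_expansion[of y])
    (simp add: lb_simps eta_simps eta_lb_frame eta_lb_xi algebra_simps)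

text \<open>Left multiplication by the quaternion units on the horizontal space, with
  \<open>e1, e2, e3, e4\<close> in the role of \<open>1, i, j, k\<close>.\<close>

definition "qI x = g x e1 *\<^sub>R e2 - g x e2 *\<^sub>R e1 + g x e3 *\<^sub>R e4 - g x e4 *\<^sub>R e3"
definition "qJ x = g x e1 *\<^sub>R e3 - g x e3 *\<^sub>R e1 - g x e2 *\<^sub>R e4 + g x e4 *\<^sub>R e2"
definition "qK x = g x e1 *\<^sub>R e4 - g x e4 *\<^sub>R e1 + g x e2 *\<^sub>R e3 - g x e3 *\<^sub>R e2"

text \<open>The Koszul formula for the Levi-Civita connection of the horizontal metric, paired with a
  frame vector at \<open>e1\<close>.\<close>

definition "conn e x = (g (lb x e1) e - g (lb e1 e) x + g (lb e x) e1) / 2"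

lemma linear_q: "linear qI" "linear qJ" "linear qK"
  by (rule linearI; simp add: qI_def qJ_def qK_def g_simps algebra_simps)+

lemma linear_conn: "linear (conn e)"
  by (rule linearI) (simp_all add: conn_def g_simps lb_simps field_simps)

lemma eta_q: "\<eta> (qI x) = 0" "\<eta> (qJ x) = 0" "\<eta> (qK x) = 0"
  by (simp_all add: qI_def qJ_def qK_def eta_simps eta_e)

lemma q_e:
  "qI e1 = e2" "qI e2 = - e1" "qI e3 = e4" "qI e4 = - e3"
  "qJ e1 = e3" "qJ e2 = - e4" "qJ e3 = - e1" "qJ e4 = e2"
  "qK e1 = e4" "qK e2 = e3" "qK e3 = - e2" "qK e4 = - e1"
  by (simp_all add: qI_def qJ_def qK_def orthonormal)

lemma q_q:
  assumes "\<eta> x = 0"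
  shows "qI (qI x) = - x" "qJ (qJ x) = - x" "qK (qK x) = - x" "qI (qJ x) = qK x"
    "qJ (qI x) = - qK x" "qJ (qK x) = qI x" "qK (qJ x) = - qI x" "qK (qI x) = qJ x"
    "qI (qK x) = - qJ x"
  by (rule vector_eqI;
      simp add: qI_def qJ_def qK_def g_simps eta_simps orthonormal eta_e assms)+

text \<open>Twelve linear relations among the 24 horizontal structure constants: four from the
  Nijenhuis identity at \<open>e1, e2\<close>, four from the closed fundamental form, and four from
  d(d eta) = 0 after division by \<open>p\<close>.\<close>

lemma horizontal_identities:
  shows "g (lb e3 e4) e1 - g (lb e1 e2) e1 + g (lb e1 e4) e3 - g (lb e2 e3) e3 = 0"
    and "g (lb e3 e4) e2 - g (lb e1 e2) e2 + g (lb e1 e4) e4 - g (lb e2 e3) e4 = 0"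
    and "g (lb e3 e4) e3 - g (lb e1 e2) e3 - g (lb e1 e4) e1 + g (lb e2 e3) e1 = 0"
    and "g (lb e3 e4) e4 - g (lb e1 e2) e4 - g (lb e1 e4) e2 + g (lb e2 e3) e2 = 0"
    and "- g (lb e1 e2) e1 - g (lb e1 e3) e4 + g (lb e2 e3) e3 = 0"
    and "- g (lb e1 e2) e2 - g (lb e1 e4) e4 + g (lb e2 e4) e3 = 0"
    and "- g (lb e1 e3) e2 + g (lb e1 e4) e1 + g (lb e3 e4) e3 = 0"
    and "- g (lb e2 e3) e2 + g (lb e2 e4) e1 + g (lb e3 e4) e4 = 0"
    and "g (lb e1 e2) e4 - g (lb e2 e3) e2 - g (lb e1 e3) e1 = 0"
    and "- g (lb e1 e2) e3 - g (lb e2 e4) e2 - g (lb e1 e4) e1 = 0"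
    and "- g (lb e1 e3) e3 - g (lb e3 e4) e2 - g (lb e1 e4) e4 = 0"
    and "- g (lb e2 e3) e3 + g (lb e3 e4) e1 - g (lb e2 e4) e4 = 0"
proof -
  show "g (lb e3 e4) e1 - g (lb e1 e2) e1 + g (lb e1 e4) e3 - g (lb e2 e3) e3 = 0"
    using nijenhuis_g[of e1 e1 e2] by (simp add: phi_e eta_e lb_simps g_simps lb_e_skew)
  show "g (lb e3 e4) e2 - g (lb e1 e2) e2 + g (lb e1 e4) e4 - g (lb e2 e3) e4 = 0"
    using nijenhuis_g[of e2 e1 e2] by (simp add: phi_e eta_e lb_simps g_simps lb_e_skew)
  show "g (lb e3 e4) e3 - g (lb e1 e2) e3 - g (lb e1 e4) e1 + g (lb e2 e3) e1 = 0"
    using nijenhuis_g[of e3 e1 e2] by (simp add: phi_e eta_e lb_simps g_simps lb_e_skew)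
  show "g (lb e3 e4) e4 - g (lb e1 e2) e4 - g (lb e1 e4) e2 + g (lb e2 e3) e2 = 0"
    using nijenhuis_g[of e4 e1 e2] by (simp add: phi_e eta_e lb_simps g_simps lb_e_skew)
  show "- g (lb e1 e2) e1 - g (lb e1 e3) e4 + g (lb e2 e3) e3 = 0"
    using fundamental_closed[of e1 e2 e3] by (simp add: phi_e g_simps)
  show "- g (lb e1 e2) e2 - g (lb e1 e4) e4 + g (lb e2 e4) e3 = 0"
    using fundamental_closed[of e1 e2 e4] by (simp add: phi_e g_simps)
  show "- g (lb e1 e3) e2 + g (lb e1 e4) e1 + g (lb e3 e4) e3 = 0"
    using fundamental_closed[of e1 e3 e4] by (simp add: phi_e g_simps)
  show "- g (lb e2 e3) e2 + g (lb e2 e4) e1 + g (lb e3 e4) e4 = 0"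
    using fundamental_closed[of e2 e3 e4] by (simp add: phi_e g_simps)
  have "p * (g (lb e1 e2) e4 - g (lb e2 e3) e2 - g (lb e1 e3) e1) = 0"
    "p * (- g (lb e1 e2) e3 - g (lb e2 e4) e2 - g (lb e1 e4) e1) = 0"
    "p * (- g (lb e1 e3) e3 - g (lb e3 e4) e2 - g (lb e1 e4) e4) = 0"
    "p * (- g (lb e2 e3) e3 + g (lb e3 e4) e1 - g (lb e2 e4) e4) = 0"
    using eta_closed[of e1 e2 e3] eta_closed[of e1 e2 e4] eta_closed[of e1 e3 e4]
      eta_closed[of e2 e3 e4]
    by (simp_all add: eta_lb_frame lb_e_skew lb_simps g_simps eta_simps algebra_simps)
  then show "g (lb e1 e2) e4 - g (lb e2 e3) e2 - g (lb e1 e3) e1 = 0"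
    "- g (lb e1 e2) e3 - g (lb e2 e4) e2 - g (lb e1 e4) e1 = 0"
    "- g (lb e1 e3) e3 - g (lb e3 e4) e2 - g (lb e1 e4) e4 = 0"
    "- g (lb e2 e3) e3 + g (lb e3 e4) e1 - g (lb e2 e4) e4 = 0"
    using p_nonzero by simp_all
qed

text \<open>This is torsion-freeness of a connection with values in the span of
  \<open>qI, qJ, qK\<close>. Such an endomorphism is determined by its value at \<open>e1\<close>,
  whose coordinates are the \<open>conn\<close> coefficients. The defect \<open>R\<close> is
  bilinear and alternating, so six frame pairs suffice.\<close>

lemma horizontal_bracket:
  assumes "\<eta> x = 0" "\<eta> y = 0"
  shows "lb x y = \<eta> (lb x y) *\<^sub>R \<xi>
    + (conn e2 x *\<^sub>R qI y + conn e3 x *\<^sub>R qJ y + conn e4 x *\<^sub>R qK y)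
    - (conn e2 y *\<^sub>R qI x + conn e3 y *\<^sub>R qJ x + conn e4 y *\<^sub>R qK x)"
proof -
  define R where "R x y = lb x y - \<eta> (lb x y) *\<^sub>R \<xi>
    - (conn e2 x *\<^sub>R qI y + conn e3 x *\<^sub>R qJ y + conn e4 x *\<^sub>R qK y)
    + (conn e2 y *\<^sub>R qI x + conn e3 y *\<^sub>R qJ x + conn e4 y *\<^sub>R qK x)" for x y :: 'a
  have R: "bilinear R"
    unfolding bilinear_def
    by (intro conjI allI linearI)
      (simp_all add: R_def lb_simps eta_simps linear_add[OF linear_conn] linear_scale[OF linear_conn]
        linear_q[THEN linear_add] linear_q[THEN linear_scale] algebra_simps)
  have R_self: "R x x = 0" for x
    by (simp add: R_def lb_self eta_simps)
  have R_skew: "R x y = - R y x" for x y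
    by (simp add: R_def lb_skew[of x y] eta_simps)
  have "R e1 e2 = 0" "R e1 e3 = 0" "R e1 e4 = 0" "R e2 e3 = 0" "R e2 e4 = 0" "R e3 e4 = 0"
    by (rule vector_eqI;
        simp add: R_def q_e conn_def lb_simps g_simps eta_simps eta_lb_e lb_e_skew orthonormal
          g_xi eta_e field_simps;
        insert horizontal_identities; linarith)+
  note R0 = this R_self R_skew[of e2 e1] R_skew[of e3 e1] R_skew[of e4 e1] R_skew[of e3 e2]
    R_skew[of e4 e2] R_skew[of e4 e3]
  have "R x y = 0"
    by (subst frame_expansion[of x], subst frame_expansion[of y])
      (simp add: assms bilinear_ladd[OF R] bilinear_radd[OF R] bilinear_lmul[OF R]
        bilinear_rmul[OF R] R0)
  then show ?thesis
    by (simp add: R_def algebra_simps)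
qed

text \<open>On horizontal vectors ad xi is skew, commutes with \<open>\<phi>\<close> and preserves d
  eta. It therefore lies in the same span and is determined by its value at
  \<open>e1\<close>.\<close>

lemma xi_bracket:
  assumes "\<eta> x = 0"
  shows "lb \<xi> x = g (lb \<xi> e1) e2 *\<^sub>R qI x + g (lb \<xi> e1) e3 *\<^sub>R qJ x + g (lb \<xi> e1) e4 *\<^sub>R qK x"
proof -
  have diag: "g (lb \<xi> e) e = 0" if "\<eta> e = 0" for e
    using lb_xi_skew[OF that, of e] by simp
  \<comment> \<open>Invariance of d eta under ad xi gives the one relation that skewness and
    \<open>\<phi>\<close> do not.\<close>
  have "p * g (lb \<xi> e4) e2 = p * g (lb \<xi> e1) e3"
    using eta_closed[of \<xi> e1 e4]
    by (simp add: eta_lb_frame eta_lb_xi lb_skew[of _ \<xi>] lb_simps g_simps eta_simps)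
  then have "g (lb \<xi> e4) e2 = g (lb \<xi> e1) e3"
    using p_nonzero by simp
  note 24 = this lb_xi_skew[OF eta_e(2), of e4]
  have 3: "lb \<xi> e3 = \<phi> (lb \<xi> e1)"
    using lb_xi_phi[of e1] by (simp add: phi_e)
  have 23: "g (lb \<xi> e2) e3 = g (lb \<xi> e1) e4"
    using lb_xi_skew[OF eta_e(2), of e3] by (simp add: 3 g_phi_left phi_e)
  note A = diag[OF eta_e(1)] diag[OF eta_e(2)] diag[OF eta_e(3)] diag[OF eta_e(4)] 23 24
    lb_xi_skew[OF eta_e(1), of e2] lb_xi_skew[OF eta_e(1), of e3] lb_xi_skew[OF eta_e(1), of e4]
    lb_xi_skew[OF eta_e(2), of e3] lb_xi_skew[OF eta_e(3), of e4]
  have 34: "g (lb \<xi> e3) e4 = g (lb \<xi> e1) e2"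
    by (simp add: 3 g_phi_left phi_e g_simps)
  define Q where
    "Q x = g (lb \<xi> e1) e2 *\<^sub>R qI x + g (lb \<xi> e1) e3 *\<^sub>R qJ x + g (lb \<xi> e1) e4 *\<^sub>R qK x" for x :: 'a
  have Q: "linear Q"
    by (rule linearI)
      (simp_all add: Q_def linear_q[THEN linear_add] linear_q[THEN linear_scale] algebra_simps)
  have e: "lb \<xi> e1 = Q e1" "lb \<xi> e2 = Q e2" "lb \<xi> e3 = Q e3" "lb \<xi> e4 = Q e4"
    by (rule vector_eqI; simp add: Q_def q_e g_simps eta_simps orthonormal eta_e eta_lb_xi;
        insert A 34; linarith)+
  have "lb \<xi> x = Q x"
    by (subst (1 2) frame_expansion[of x])
      (simp add: assms lb_simps linear_add[OF Q] linear_scale[OF Q] e)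
  then show ?thesis
    by (simp add: Q_def)
qed

lemma lb_eq: "lb x y = \<eta> (lb x y) *\<^sub>R \<xi>"
proof -
  note quaternionic = quaternionic_lie_bracket[OF lie dim linear_q linear_conn linear_conn linear_conn
      linear_eta eta_xi eta_q q_q horizontal_bracket xi_bracket eta_e1 eta_e2 eta_lb_12]
  have core: "lb \<xi> x = 0" "lb x y = \<eta> (lb x y) *\<^sub>R \<xi>" if "\<eta> x = 0" "\<eta> y = 0" for x y
    using that by (auto intro: quaternionic)
  have split: "x = (x - \<eta> x *\<^sub>R \<xi>) + \<eta> x *\<^sub>R \<xi>" and h: "\<eta> (x - \<eta> x *\<^sub>R \<xi>) = 0" for x
    by (simp_all add: eta_simps)
  have xi: "lb \<xi> x = 0" for x
    by (subst split[of x]) (simp only: bilinear_radd[OF bilinear_lb] core(1)[OF h h], simp add: lb_simps)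
  then have xi': "lb x \<xi> = 0" for x
    by (simp add: lb_skew[of x \<xi>])
  have "lb x y = lb (x - \<eta> x *\<^sub>R \<xi>) (y - \<eta> y *\<^sub>R \<xi>)"
    by (simp add: lb_simps xi xi')
  then show ?thesis
    using core(2)[OF h h, of x y] by simp
qed

section \<open>The isomorphism with the Heisenberg algebra\<close>

lemma lie_isomorphic_h5: "lie_isomorphic lb h5_bracket"
proof -
  \<comment> \<open>In the frame, d eta is -p (e12 - e34). Exchanging \<open>e3\<close> and
    \<open>e4\<close> makes the two signs agree, and dividing \<open>- \<eta>\<close> by
    \<open>p\<close> normalises the last coordinate.\<close>
  define f :: "'a \<Rightarrow> real^5" where "f x = axis 1 (g x e1) + axis 2 (g x e2) + axis 3 (g x e4)
    + axis 4 (g x e3) + axis 5 (- \<eta> x / p)" for x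
  define f' :: "real^5 \<Rightarrow> 'a" where "f' v = (v $ 1) *\<^sub>R e1 + (v $ 2) *\<^sub>R e2 + (v $ 4) *\<^sub>R e3
    + (v $ 3) *\<^sub>R e4 + (- p * v $ 5) *\<^sub>R \<xi>" for v
  have f: "f x $ 1 = g x e1" "f x $ 2 = g x e2" "f x $ 3 = g x e4" "f x $ 4 = g x e3"
    "f x $ 5 = - \<eta> x / p" for x
    by (simp_all add: f_def axis_def)
  have "linear f"
    by (rule linearI)
      (simp_all add: vec_eq_iff f_def axis_def g_simps eta_simps add_divide_distrib diff_divide_distrib)
  moreover have "bij f"
  proof (rule o_bij[of f'])
    show "f' \<circ> f = id"
    proof
      fix x
      show "(f' \<circ> f) x = id x"
        by (subst (2) frame_expansion) (simp add: f'_def f p_nonzero)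
    qed
    have "f (f' v) $ i = v $ i" for v i
      using exhaust_5[of i]
      by (auto simp: f) (simp_all add: f'_def g_simps eta_simps orthonormal g_xi eta_e p_nonzero)
    then show "f \<circ> f' = id"
      by (simp add: fun_eq_iff vec_eq_iff)
  qed
  moreover have "f (lb x y) = h5_bracket (f x) (f y)" for x y
  proof -
    have "g (lb x y) e = 0" if "\<eta> e = 0" for e
      by (subst lb_eq) (simp add: g_simps g_xi that)
    then have "f (lb x y) = axis 5 (- \<eta> (lb x y) / p)"
      by (simp add: f_def eta_e vec_eq_iff axis_def)
    also have "- \<eta> (lb x y) / p
      = - (g x e1 * g y e2 - g x e2 * g y e1 + g x e4 * g y e3 - g x e3 * g y e4)"
      using p_nonzero by (simp add: eta_lb field_simps)
    also have "axis 5 \<dots> = h5_bracket (f x) (f y)"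
      by (simp add: h5_bracket_def f)
    finally show ?thesis .
  qed
  ultimately show ?thesis
    unfolding lie_isomorphic_def by blast
qed

end

theorem theorem2p3:
  fixes S :: "'a::real_vector acm_data"
  assumes "anti_quasi_sasakian S"
    and "dim (UNIV :: 'a set) = 5"
    and "\<not> cokaehler S"
  shows "\<exists>c. c \<noteq> 0 \<and> lie_isomorphic (br (homothetic_deformation c S)) h5_bracket"
proof -
  interpret anti_quasi_sasakian_algebra S
    by unfold_locales (rule assms(1))
  \<comment> \<open>If d eta vanished, the right side of the Nijenhuis identity would vanish too,
    and the structure would be cokaehler.\<close>
  have "\<exists>x y. \<eta> (lb x y) \<noteq> 0"
    using assms(1,3)
    by (auto simp: anti_quasi_sasakian_def cokaehler_def ce_d1_def)
  then obtain x y where "\<eta> (lb x y) \<noteq> 0"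
    by blast
  then obtain e1 e2 where "\<eta> e1 = 0" "\<eta> e2 = 0" "g e1 e1 = 1" "g e2 e2 = 1" "g e1 e2 = 0"
    "g e1 (\<phi> e2) = 0" "\<eta> (lb e1 (\<phi> e2)) = 0" "\<eta> (lb e1 e2) \<noteq> 0"
    by (rule exists_adapted_frame)
  then interpret adapted_frame S e1 e2
    by unfold_locales (use assms(2) in auto)
  \<comment> \<open>A homothetic deformation leaves the bracket unchanged, so the witness is
    1.\<close>
  have "lie_isomorphic (br (homothetic_deformation 1 S)) h5_bracket"
    using lie_isomorphic_h5 by (simp add: homothetic_deformation_def)
  then show ?thesis
    by (intro exI[of _ 1]) simp
qed

end
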